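(* Let $L\in\mathcal{F}^2$ be a convex-concave function with unique saddle point $z^*=(x^*,y^* )$ and let $F(x,y)=(\nabla_x L(x,y),-\nabla_y L(x,y))$. Let $z_0\in\mathbb{R}^n\times\mathbb{R}^m$ and let $Z=(X,Y):[0,\infty)\to\mathbb{R}^n\times\mathbb{R}^m$ be a continuously differentiable solution of $$\dot Z(t)+t\,\nabla F(Z(t))\,\dot Z(t)=-2F(Z(t)),\qquad t\ge 0,\qquad Z(0)=z_0 .$$ Then for all $t>0$, $$L(X(t),y^* )-L(x^*,Y(t))\le\frac{\|z_0-z^*\|^2}{2t},\qquad \|F(Z(t))\|^2\le\frac{\|z_0-z^*\|^2}{t^2}.$$ Moreover, $$\lim_{t\to\infty}t\,\bigl(L(X(t),y^* )-L(x^*,Y(t))\bigr)=0,\qquad \lim_{t\to\infty}t^2\|F(Z(t))\|^2=0.$$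
   Context: For $p\in\{1,2\}$, $\mathcal{F}^p$ denotes the class of $p$-times continuously differentiable functions $L:\mathbb{R}^n\times\mathbb{R}^m\to\mathbb{R}$, $(x,y)\mapsto L(x,y)$, that are convex in $x$ for each $y$ and concave in $y$ for each $x$, and that have a unique saddle point $z^*=(x^*,y^* )$, i.e. $L(x^*,y)\le L(x^*,y^* )\le L(x,y^* )$ for all $x,y$, where the left inequality is an equality if and only if $y=y^*$ and the right inequality is an equality if and only if $x=x^*$. Write $z=(x,y)$; $\nabla F(z)$ denotes the Jacobian matrix of $F$ at $z$; $\|\cdot\|$ and $\langle\cdot,\cdot\rangle$ are the Euclidean norm and inner product. *)

theory Defs
  imports "HOL-Analysis.Analysis"
begin

text \<open>\<open>k\<close>-times continuous differentiability on the whole space: \<open>f\<close> is Frechet differentiable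
  everywhere and all its directional derivatives are \<open>(k - 1)\<close>-times continuously differentiable.\<close>

primrec times_cont_diff ::
  "nat \<Rightarrow> ('a::real_normed_vector \<Rightarrow> 'b::real_normed_vector) \<Rightarrow> bool" where
  "times_cont_diff 0 f \<longleftrightarrow> continuous_on UNIV f"
| "times_cont_diff (Suc k) f \<longleftrightarrow>
     f differentiable_on UNIV \<and>
     (\<forall>v. times_cont_diff k (\<lambda>x. frechet_derivative f (at x) v))"

definition grad :: "('a::euclidean_space \<Rightarrow> real) \<Rightarrow> 'a \<Rightarrow> 'a" where
  "grad f x = (THE D. GDERIV f x :> D)"

lemma GDERIV_unique:
  assumes "GDERIV f x :> D" "GDERIV f x :> E"
  shows "D = E"
proof -
  have "(\<lambda>h. inner h D) = (\<lambda>h. inner h E)"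
    using assms unfolding gderiv_def by (rule has_derivative_unique)
  then show ?thesis
    by (metis inner_commute vector_eq_rdot)
qed

lemma GDERIV_grad:
  fixes f :: "'a::euclidean_space \<Rightarrow> real"
  assumes "f differentiable (at x)"
  shows "GDERIV f x :> grad f x"
proof -
  obtain f' where f': "(f has_derivative f') (at x)"
    using assms unfolding differentiable_def by blast
  have "f' = (\<lambda>h. inner h (adjoint f' 1))"
    using adjoint_works[OF has_derivative_linear[OF f']] by (auto simp: fun_eq_iff)
  with f' have "GDERIV f x :> adjoint f' 1"
    unfolding gderiv_def by metis
  then show ?thesis
    unfolding grad_def by (metis GDERIV_unique theI)
qed

lemma grad_eqI: "GDERIV f x :> D \<Longrightarrow> grad f x = D"
  unfolding grad_def by (blast intro: GDERIV_unique)

text \<open>The saddle operator \<open>F = (\<nabla>\<^sub>x L, - \<nabla>\<^sub>y L)\<close>.\<close>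

definition saddle_op ::
  "('a::euclidean_space \<times> 'b::euclidean_space \<Rightarrow> real) \<Rightarrow> 'a \<times> 'b \<Rightarrow> 'a \<times> 'b" where
  "saddle_op L = (\<lambda>(x, y). (grad (\<lambda>u. L (u, y)) x, - grad (\<lambda>v. L (x, v)) y))"

text \<open>A saddle point at which each of the two inequalities is strict away from the saddle point
  itself.  This is more than there being only one saddle point: \<open>L (x, y) = x * y\<close> has only
  the saddle point \<open>(0, 0)\<close>, but not in this sense.\<close>

definition unique_saddle_point :: "('a \<times> 'b \<Rightarrow> real) \<Rightarrow> 'a \<times> 'b \<Rightarrow> bool" where
  "unique_saddle_point L = (\<lambda>(xs, ys).
     (\<forall>x y. L (xs, y) \<le> L (xs, ys) \<and> L (xs, ys) \<le> L (x, ys)) \<and>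
     (\<forall>y. L (xs, y) = L (xs, ys) \<longleftrightarrow> y = ys) \<and>
     (\<forall>x. L (xs, ys) = L (x, ys) \<longleftrightarrow> x = xs))"

lemma unique_saddle_point_unique:
  assumes "unique_saddle_point L (xs, ys)"
    and sad: "\<And>x y. L (x', y) \<le> L (x', y') \<and> L (x', y') \<le> L (x, y')"
  shows "x' = xs \<and> y' = ys"
proof -
  have le: "L (xs, y') \<le> L (xs, ys)" "L (xs, ys) \<le> L (x', ys)"
    and eqs: "L (xs, y') = L (xs, ys) \<longleftrightarrow> y' = ys" "L (xs, ys) = L (x', ys) \<longleftrightarrow> x' = xs"
    using assms(1) by (auto simp: unique_saddle_point_def)
  have "L (x', ys) \<le> L (xs, y')"
    using sad[of ys xs] by linarith
  with le eqs show ?thesis by auto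
qed

definition saddle_class ::
  "nat \<Rightarrow> ('a::euclidean_space \<times> 'b::euclidean_space \<Rightarrow> real) set" where
  "saddle_class p = {L.
     times_cont_diff p L \<and>
     (\<forall>y. convex_on UNIV (\<lambda>x. L (x, y))) \<and>
     (\<forall>x. concave_on UNIV (\<lambda>y. L (x, y))) \<and>
     (\<exists>zs. unique_saddle_point L zs)}"

text \<open>Continuously differentiable solutions on \<open>[0, \<infinity>)\<close> of \<open>Z' + t \<nabla>F(Z) Z' = - 2 F(Z)\<close>;
  the derivative at \<open>0\<close> is one-sided.  The Jacobian matrix \<open>\<nabla>F(Z)\<close> acts on vectors as the
  Frechet derivative of \<open>F\<close>.\<close>

definition is_C1_solution ::
  "('a::real_normed_vector \<Rightarrow> 'a) \<Rightarrow> 'a \<Rightarrow> (real \<Rightarrow> 'a) \<Rightarrow> bool" where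
  "is_C1_solution F z0 Z \<longleftrightarrow>
     (\<exists>Z'. continuous_on {0..} Z' \<and>
        (\<forall>t\<ge>0. (Z has_vector_derivative Z' t) (at t within {0..})) \<and>
        (\<forall>t\<ge>0. Z' t + t *\<^sub>R frechet_derivative F (at (Z t)) (Z' t) = - (2 *\<^sub>R F (Z t)))) \<and>
     Z 0 = z0"

end

(* Put V t = |Z t + t F(Z t) - z*|^2 with z* = (xs, ys).  The equation says that Z + t F(Z) has
   derivative -F(Z), so V' = -2 <F(Z), Z - z*> - 2 t |F(Z)|^2, where <F(Z), Z - z*> dominates the
   gap L(X, ys) - L(xs, Y) \<ge> 0 by convexity-concavity.  Hence V decreases, and expanding the
   square in V t \<le> V 0 gives both bounds.  By monotonicity of F the residual |F(Z)| decreases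
   too, so integrating V' over [t/2, t] yields (3/4) t^2 |F(Z t)|^2 \<le> V (t/2) - V t, which tends
   to 0 because V converges.  The gap is at most |F(Z)| |Z - z*| with Z - z* bounded. *)

theory Submission
  imports Defs
begin

section \<open>Monotone functions and derivatives on the half-line\<close>

lemma antimono_on_halfline_of_deriv_nonpos:
  fixes f f' :: "real \<Rightarrow> real"
  assumes ab: "0 \<le> a" "a \<le> b"
    and der: "\<And>t. a \<le> t \<Longrightarrow> t \<le> b \<Longrightarrow> (f has_real_derivative f' t) (at t within {0..})"
    and neg: "\<And>t. a \<le> t \<Longrightarrow> t \<le> b \<Longrightarrow> f' t \<le> 0"
  shows "f b \<le> f a"
proof (rule DERIV_nonpos_imp_decreasing_open[OF ab(2)])
  fix x assume x: "a < x" "x < b"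
  \<comment> \<open>Interior points have a two-sided derivative; at the endpoints, possibly 0,
    continuity suffices.\<close>
  have "at x within {0..} = at x"
    using ab x by (intro at_within_interior) simp
  then show "\<exists>y. (f has_real_derivative y) (at x) \<and> y \<le> 0"
    using der[of x] neg[of x] x by auto
next
  have "continuous (at t within {a..b}) f" if "t \<in> {a..b}" for t
    using DERIV_continuous[OF der[of t]] that ab
    by (auto intro: continuous_within_subset)
  then show "continuous_on {a..b} f"
    by (simp add: continuous_on_eq_continuous_within)
qed

lemma antimono_nonneg_convergent_at_top:
  fixes V :: "real \<Rightarrow> real"
  assumes anti: "\<And>s t. 0 \<le> s \<Longrightarrow> s \<le> t \<Longrightarrow> V t \<le> V s" and nonneg: "\<And>t. 0 \<le> V t"
  shows "\<exists>l. (V \<longlongrightarrow> l) at_top"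
proof
  let ?l = "INF t\<in>{0..}. V t"
  have bdd: "bdd_below (V ` {0..})"
    using nonneg by (rule bdd_belowI2)
  show "(V \<longlongrightarrow> ?l) at_top"
  proof (rule order_tendstoI)
    fix a assume a: "a < ?l"
    have "a < V t" if "0 \<le> t" for t
      using a cINF_lower[OF bdd, of t] that by simp
    then show "\<forall>\<^sub>F t in at_top. a < V t"
      by (intro eventually_at_top_linorderI)
  next
    fix a assume a: "?l < a"
    obtain s where s: "0 \<le> s" "V s < a"
      using a cINF_less_iff[OF _ bdd, of a] by auto
    then have "V t < a" if "s \<le> t" for t
      using anti[of s t] that by simp
    then show "\<forall>\<^sub>F t in at_top. V t < a"
      by (intro eventually_at_top_linorderI)
  qed
qed

lemma has_vector_derivative_imp_tendsto_quotient:
  assumes "(f has_vector_derivative D) (at t within S)"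
  shows "((\<lambda>s. (f s - f t) /\<^sub>R (s - t)) \<longlongrightarrow> D) (at t within S)"
proof (rule LIM_zero_cancel, rule tendsto_norm_zero_cancel)
  have "((\<lambda>s. norm ((f s - f t) - (s - t) *\<^sub>R D) / norm (s - t)) \<longlongrightarrow> 0) (at t within S)"
    using assms by (simp add: has_vector_derivative_def has_derivative_iff_norm)
  moreover have "\<forall>\<^sub>F s in at t within S. norm ((f s - f t) - (s - t) *\<^sub>R D) / norm (s - t)
      = norm ((f s - f t) /\<^sub>R (s - t) - D)"
    unfolding eventually_at_filter
  proof (intro always_eventually allI impI)
    fix s assume "s \<noteq> t"
    then have "(f s - f t) /\<^sub>R (s - t) - D = ((f s - f t) - (s - t) *\<^sub>R D) /\<^sub>R (s - t)"
      by (simp add: scaleR_diff_right)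
    then show "norm ((f s - f t) - (s - t) *\<^sub>R D) / norm (s - t)
        = norm ((f s - f t) /\<^sub>R (s - t) - D)"
      by (simp add: divide_inverse_commute)
  qed
  ultimately show "((\<lambda>s. norm ((f s - f t) /\<^sub>R (s - t) - D)) \<longlongrightarrow> 0) (at t within S)"
    by (rule Lim_transform_eventually)
qed

text \<open>For s \<noteq> t the inner product of the two difference quotients is
  \<open>inner (f s - f t) (g s - g t)\<close> times the square of 1/(s - t), hence nonnegative, and
  this survives the limit. Applied to F(Z) and Z, it turns monotonicity of F into information about
  the Jacobian along the trajectory, without a separate study of its quadratic form.\<close>

lemma monotone_vector_derivative_inner_nonneg:
  fixes f g :: "real \<Rightarrow> 'a::real_inner"
  assumes f: "(f has_vector_derivative f') (at t within S)"
    and g: "(g has_vector_derivative g') (at t within S)"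
    and nt: "at t within S \<noteq> bot"
    and mono: "\<And>s. s \<in> S \<Longrightarrow> 0 \<le> inner (f s - f t) (g s - g t)"
  shows "0 \<le> inner f' g'"
proof -
  have "((\<lambda>s. inner ((f s - f t) /\<^sub>R (s - t)) ((g s - g t) /\<^sub>R (s - t))) \<longlongrightarrow> inner f' g')
      (at t within S)"
    using f g by (intro tendsto_inner has_vector_derivative_imp_tendsto_quotient)
  moreover have "\<forall>\<^sub>F s in at t within S.
      0 \<le> inner ((f s - f t) /\<^sub>R (s - t)) ((g s - g t) /\<^sub>R (s - t))"
    unfolding eventually_at_filter
  proof (intro always_eventually allI impI)
    fix s assume "s \<in> S"
    then have "0 \<le> (inverse (s - t))\<^sup>2 * inner (f s - f t) (g s - g t)"
      using mono by simp
    then show "0 \<le> inner ((f s - f t) /\<^sub>R (s - t)) ((g s - g t) /\<^sub>R (s - t))"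
      by (simp add: power2_eq_square mult.assoc)
  qed
  ultimately show ?thesis
    using nt by (rule tendsto_lowerbound)
qed

section \<open>Convexity, gradients and the saddle operator\<close>

lemma convex_on_above_tangent_has_derivative:
  fixes f :: "'a::real_normed_vector \<Rightarrow> real"
  assumes conv: "convex_on UNIV f" and der: "(f has_derivative f') (at x)"
  shows "f x + f' (y - x) \<le> f y"
proof -
  \<comment> \<open>Restriction to the line through x and y reduces the claim to the tangent
    inequality in one real variable, between the parameters 0 and 1.\<close>
  let ?g = "\<lambda>t. f (x + t *\<^sub>R (y - x))"
  have "convex_on UNIV ?g"
  proof (rule convex_onI)
    fix t a b :: real assume t: "0 < t" "t < 1"
    have "x + ((1 - t) *\<^sub>R a + t *\<^sub>R b) *\<^sub>R (y - x)
        = (1 - t) *\<^sub>R (x + a *\<^sub>R (y - x)) + t *\<^sub>R (x + b *\<^sub>R (y - x))"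
      by (simp add: algebra_simps)
    then show "?g ((1 - t) *\<^sub>R a + t *\<^sub>R b) \<le> (1 - t) * ?g a + t * ?g b"
      using convex_onD[OF conv, of t] t by simp
  qed simp
  moreover have "(?g has_real_derivative f' (y - x)) (at 0)"
  proof -
    have "((\<lambda>t. x + t *\<^sub>R (y - x)) has_derivative (\<lambda>t. t *\<^sub>R (y - x))) (at 0)"
      by (auto intro!: derivative_eq_intros)
    then have "(?g has_derivative (\<lambda>t. f' (t *\<^sub>R (y - x)))) (at 0)"
      by (rule has_derivative_compose) (use der in simp)
    then show ?thesis
      by (rule has_derivative_imp_has_field_derivative)
        (simp add: linear_scale[OF has_derivative_linear[OF der]])
  qed
  ultimately have "?g 1 - ?g 0 \<ge> f' (y - x) * (1 - 0)"
    by (intro convex_on_imp_above_tangent) auto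
  then show ?thesis by simp
qed

lemma has_derivative_fst_arg:
  assumes "(L has_derivative L') (at (x, y))"
  shows "((\<lambda>u. L (u, y)) has_derivative (\<lambda>h. L' (h, 0))) (at x)"
  by (rule has_derivative_compose[where f = "\<lambda>u. (u, y)", OF _ assms])
    (auto intro!: derivative_eq_intros)

lemma has_derivative_snd_arg:
  assumes "(L has_derivative L') (at (x, y))"
  shows "((\<lambda>v. L (x, v)) has_derivative (\<lambda>h. L' (0, h))) (at y)"
  by (rule has_derivative_compose[where f = "\<lambda>v. (x, v)", OF _ assms])
    (auto intro!: derivative_eq_intros)

lemma inner_grad:
  fixes f :: "'a::euclidean_space \<Rightarrow> real"
  assumes "(f has_derivative f') (at x)"
  shows "inner (grad f x) h = f' h"
proof -
  have "GDERIV f x :> grad f x"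
    using assms by (intro GDERIV_grad) (auto simp: differentiable_def)
  then have "f' = (\<lambda>h. inner h (grad f x))"
    using assms has_derivative_unique unfolding gderiv_def by blast
  then show ?thesis by (simp add: inner_commute)
qed

text \<open>Each partial gradient represents the total derivative on one factor of the product.
  Linearity of a single \<open>L'\<close> can then replace computations with two gradients.\<close>

lemma inner_saddle_op:
  assumes "(L has_derivative L') (at z)"
  shows "inner (saddle_op L z) w = L' (fst w, 0) - L' (0, snd w)"
proof -
  obtain x y where z: "z = (x, y)" by (cases z)
  note der = assms[unfolded z]
  show ?thesis
    by (simp add: z saddle_op_def inner_prod_def inner_grad[OF has_derivative_fst_arg[OF der]]
        inner_grad[OF has_derivative_snd_arg[OF der]])
qed

lemma times_cont_diff_2D:
  assumes "times_cont_diff 2 f"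
  shows "f differentiable (at x)"
    and "(\<lambda>x. frechet_derivative f (at x) v) differentiable (at x)"
  using assms by (simp_all only: numeral_2_eq_2 times_cont_diff.simps differentiable_on_def UNIV_I)

text \<open>Every coordinate of the operator in the standard basis is a difference of two
  directional derivatives of L in fixed directions, and these are differentiable since L is twice
  continuously differentiable.\<close>

lemma saddle_op_differentiable:
  fixes L :: "'a::euclidean_space \<times> 'b::euclidean_space \<Rightarrow> real"
  assumes "times_cont_diff 2 L"
  shows "saddle_op L differentiable (at z)"
proof -
  let ?D = "\<lambda>v z. frechet_derivative L (at z) v"
  note dL = times_cont_diff_2D(1)[OF assms] and dD = times_cont_diff_2D(2)[OF assms]
  have "saddle_op L = (\<lambda>z. \<Sum>b\<in>Basis. (?D (fst b, 0) z - ?D (0, snd b) z) *\<^sub>R b)"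
  proof
    fix z
    have "inner (saddle_op L z) b = ?D (fst b, 0) z - ?D (0, snd b) z" for b
      by (rule inner_saddle_op) (use dL frechet_derivative_works in blast)
    then show "saddle_op L z = (\<Sum>b\<in>Basis. (?D (fst b, 0) z - ?D (0, snd b) z) *\<^sub>R b)"
      by (metis (no_types, lifting) euclidean_representation sum.cong)
  qed
  then show ?thesis
    using dD by (auto intro!: differentiable_sum differentiable_scaleR differentiable_diff)
qed

text \<open>The tangent inequalities for L(., y) at x and for -L(x, .) at y are added, and L(x, y)
  cancels. With (u, v) the saddle point this bounds the gap; used twice with the points exchanged it
  gives monotonicity of the operator.\<close>

lemma saddle_gap_le_inner_saddle_op:
  fixes L :: "'a::euclidean_space \<times> 'b::euclidean_space \<Rightarrow> real"
  assumes conv: "convex_on UNIV (\<lambda>u. L (u, y))" and conc: "concave_on UNIV (\<lambda>v. L (x, v))"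
    and der: "L differentiable (at (x, y))"
  shows "L (x, v) - L (u, y) \<le> inner (saddle_op L (x, y)) ((x, y) - (u, v))"
proof -
  obtain L' where L': "(L has_derivative L') (at (x, y))"
    using der by (auto simp: differentiable_def)
  note lin = has_derivative_linear[OF L']
  have "L (x, y) + L' (u - x, 0) \<le> L (u, y)"
    using convex_on_above_tangent_has_derivative[OF conv has_derivative_fst_arg[OF L']] .
  moreover have "- L (x, y) + - L' (0, v - y) \<le> - L (x, v)"
    using convex_on_above_tangent_has_derivative[OF conc[unfolded concave_on_def]
        has_derivative_minus[OF has_derivative_snd_arg[OF L']]] .
  moreover have "inner (saddle_op L (x, y)) ((x, y) - (u, v)) = L' (x - u, 0) - L' (0, y - v)"
    using inner_saddle_op[OF L'] by simp
  moreover have "L' (u - x, 0) = - L' (x - u, 0)" "L' (0, v - y) = - L' (0, y - v)"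
    using linear_neg[OF lin, of "(x - u, 0)"] linear_neg[OF lin, of "(0, y - v)"] by simp_all
  ultimately show ?thesis by linarith
qed

section \<open>The flow of a monotone operator\<close>

lemma monotone_flow_estimates:
  fixes F :: "'a::real_inner \<Rightarrow> 'a" and Z :: "real \<Rightarrow> 'a"
  assumes mono: "\<And>z w. 0 \<le> inner (F z - F w) (z - w)"
    and zs: "\<And>z. 0 \<le> inner (F z) (z - zs)"
    and diff: "\<And>z. F differentiable (at z)"
    and sol: "is_C1_solution F z0 Z"
  shows monotone_flow_bound: "\<And>t. 0 \<le> t \<Longrightarrow>
        (norm (Z t - zs))\<^sup>2 + 2 * t * inner (F (Z t)) (Z t - zs) + t\<^sup>2 * (norm (F (Z t)))\<^sup>2
          \<le> (norm (z0 - zs))\<^sup>2"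
    and monotone_flow_residual_tendsto_0: "((\<lambda>t. t\<^sup>2 * (norm (F (Z t)))\<^sup>2) \<longlongrightarrow> 0) at_top"
proof -
  obtain Z' where Z': "\<And>t. 0 \<le> t \<Longrightarrow> (Z has_vector_derivative Z' t) (at t within {0..})"
    and ode: "\<And>t. 0 \<le> t \<Longrightarrow>
        Z' t + t *\<^sub>R frechet_derivative F (at (Z t)) (Z' t) = - (2 *\<^sub>R F (Z t))"
    and Z0: "Z 0 = z0"
    using sol by (auto simp: is_C1_solution_def)
  \<comment> \<open>\<open>G\<close> will be the time derivative of \<phi> = F(Z), and
    \<open>V\<close> is the squared length of \<open>W\<close>. In these terms the equation reads Z'
    + t G = -2 \<phi>.\<close>
  define G where "G t = frechet_derivative F (at (Z t)) (Z' t)" for t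
  define \<phi> where "\<phi> t = F (Z t)" for t
  define W where "W t = Z t - zs + t *\<^sub>R \<phi> t" for t
  define V where "V t = inner (W t) (W t)" for t
  have Z'_eq: "Z' t = - (2 *\<^sub>R \<phi> t) - t *\<^sub>R G t" if "0 \<le> t" for t
    using ode[OF that] by (simp add: G_def \<phi>_def algebra_simps)
  have \<phi>': "(\<phi> has_vector_derivative G t) (at t within {0..})" if "0 \<le> t" for t
  proof -
    have "(F has_derivative frechet_derivative F (at (Z t))) (at (Z t) within Z ` {0..})"
      using diff frechet_derivative_works has_derivative_at_withinI by blast
    then have "(F \<circ> Z has_vector_derivative G t) (at t within {0..})"
      unfolding G_def using vector_derivative_diff_chain_within[OF Z'[OF that]] by blast
    then show ?thesis by (simp add: \<phi>_def[abs_def] comp_def)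
  qed
  have G_nonneg: "0 \<le> inner (G t) (Z' t)" if "0 \<le> t" for t
  proof (rule monotone_vector_derivative_inner_nonneg[OF \<phi>'[OF that] Z'[OF that]])
    \<comment> \<open>A right neighbourhood of t stays in the half-line even for t = 0, so the limit
      at t within it is meaningful.\<close>
    have "at_right t \<le> at t within {0..}"
      using that by (intro at_le) auto
    then show "at t within {0..} \<noteq> bot"
      using trivial_limit_at_right_real[of t] by (metis bot.extremum_uniqueI)
  qed (simp add: \<phi>_def mono)
  have \<phi>_anti: "inner (\<phi> t) (\<phi> t) \<le> inner (\<phi> s) (\<phi> s)" if st: "0 \<le> s" "s \<le> t" for s t
  proof (rule antimono_on_halfline_of_deriv_nonpos[OF st])
    fix r assume "s \<le> r" "r \<le> t"
    then have r: "0 \<le> r" using st by simp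
    show "((\<lambda>r. inner (\<phi> r) (\<phi> r)) has_real_derivative 2 * inner (\<phi> r) (G r))
        (at r within {0..})"
      using has_derivative_inner[OF \<phi>'[OF r, unfolded has_vector_derivative_def]
          \<phi>'[OF r, unfolded has_vector_derivative_def]]
      by (rule has_derivative_imp_has_field_derivative) (simp add: inner_commute algebra_simps)
    \<comment> \<open>Take the inner product of the equation with \<open>G r\<close>: the derivative
      of |\<phi>|^2 becomes a sum of two nonpositive terms.\<close>
    have "2 * inner (\<phi> r) (G r) = - inner (G r) (Z' r) - r * inner (G r) (G r)"
      by (simp add: Z'_eq[OF r] inner_diff_right inner_commute)
    then show "2 * inner (\<phi> r) (G r) \<le> 0"
      using G_nonneg[OF r] mult_nonneg_nonneg[OF r inner_ge_zero[of "G r"]] by linarith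
  qed
  have W': "(W has_vector_derivative - \<phi> t) (at t within {0..})" if "0 \<le> t" for t
    unfolding W_def
    by (rule derivative_eq_intros Z'[OF that] \<phi>'[OF that] refl)+
      (simp add: Z'_eq[OF that] algebra_simps scaleR_2)
  have \<phi>_inner_W: "inner (\<phi> t) (W t) = inner (\<phi> t) (Z t - zs) + t * inner (\<phi> t) (\<phi> t)" for t
    by (simp add: W_def inner_add_right)
  have V': "(V has_real_derivative - 2 * inner (\<phi> t) (Z t - zs) - 2 * t * inner (\<phi> t) (\<phi> t))
      (at t within {0..})" if "0 \<le> t" for t
    unfolding V_def
    using has_derivative_inner[OF W'[OF that, unfolded has_vector_derivative_def]
        W'[OF that, unfolded has_vector_derivative_def]]
    by (rule has_derivative_imp_has_field_derivative)
      (simp add: inner_commute[of "W t" "\<phi> t"] \<phi>_inner_W distrib_left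
        right_diff_distrib mult_ac)
  \<comment> \<open>This is V' \<le> -2 r |\<phi>(r)|^2 \<le> -2 r |\<phi>(t)|^2 integrated over
    [s, t]. No integral is formed: with the endpoint t frozen in the residual, V(r) + r^2
    |\<phi>(t)|^2 is a decreasing function of r.\<close>
  have decay: "V t + (t\<^sup>2 - s\<^sup>2) * inner (\<phi> t) (\<phi> t) \<le> V s" if st: "0 \<le> s" "s \<le> t" for s t
  proof -
    have "V t + t\<^sup>2 * inner (\<phi> t) (\<phi> t) \<le> V s + s\<^sup>2 * inner (\<phi> t) (\<phi> t)"
    proof (rule antimono_on_halfline_of_deriv_nonpos[OF st])
      fix r assume sr: "s \<le> r" "r \<le> t"
      then have r: "0 \<le> r" using st by simp
      show "((\<lambda>r. V r + r\<^sup>2 * inner (\<phi> t) (\<phi> t)) has_real_derivative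
          - 2 * inner (\<phi> r) (Z r - zs) - 2 * r * inner (\<phi> r) (\<phi> r) + 2 * r * inner (\<phi> t) (\<phi> t))
          (at r within {0..})"
        by (rule derivative_eq_intros V'[OF r] refl)+ simp
      have "r * inner (\<phi> t) (\<phi> t) \<le> r * inner (\<phi> r) (\<phi> r)"
        using \<phi>_anti[OF r sr(2)] r by (rule mult_left_mono)
      then show "- 2 * inner (\<phi> r) (Z r - zs) - 2 * r * inner (\<phi> r) (\<phi> r)
          + 2 * r * inner (\<phi> t) (\<phi> t) \<le> 0"
        using zs[of "Z r"] by (simp add: \<phi>_def)
    qed
    then show ?thesis by (simp add: algebra_simps)
  qed
  have V_anti: "V t \<le> V s" if st: "0 \<le> s" "s \<le> t" for s t
  proof -
    have "0 \<le> (t\<^sup>2 - s\<^sup>2) * inner (\<phi> t) (\<phi> t)"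
      using st by (simp add: power_mono)
    then show ?thesis using decay[OF st] by simp
  qed
  show "(norm (Z t - zs))\<^sup>2 + 2 * t * inner (F (Z t)) (Z t - zs) + t\<^sup>2 * (norm (F (Z t)))\<^sup>2
      \<le> (norm (z0 - zs))\<^sup>2" if "0 \<le> t" for t
  proof -
    have "V t = (norm (Z t - zs))\<^sup>2 + 2 * t * inner (F (Z t)) (Z t - zs)
        + t\<^sup>2 * (norm (F (Z t)))\<^sup>2"
      by (simp add: V_def W_def \<phi>_def power2_norm_eq_inner power2_eq_square[of t] inner_add_left
          inner_add_right inner_commute[of "Z t - zs" "F (Z t)"] distrib_left)
    moreover have "V 0 = (norm (z0 - zs))\<^sup>2"
      by (simp add: V_def W_def Z0 power2_norm_eq_inner)
    ultimately show ?thesis using V_anti[of 0 t] that by simp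
  qed
  obtain l where l: "(V \<longlongrightarrow> l) at_top"
    using antimono_nonneg_convergent_at_top[of V, OF V_anti] by (auto simp: V_def)
  have "filterlim (\<lambda>t::real. t / 2) at_top at_top"
    using filterlim_tendsto_pos_mult_at_top[OF tendsto_const[of "1 / 2"] _ filterlim_ident] by simp
  then have "((\<lambda>t. V (t / 2)) \<longlongrightarrow> l) at_top"
    by (rule filterlim_compose[OF l])
  \<comment> \<open>The factor 4/3 inverts the 3/4 in t^2 - (t/2)^2 = (3/4) t^2, which
    \<open>decay\<close> produces for s = t/2.\<close>
  then have lim: "((\<lambda>t. 4 / 3 * (V (t / 2) - V t)) \<longlongrightarrow> 0) at_top"
    using l by (auto intro!: tendsto_eq_intros)
  have "\<forall>\<^sub>F t in at_top. t\<^sup>2 * (norm (F (Z t)))\<^sup>2 \<le> 4 / 3 * (V (t / 2) - V t)"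
    using eventually_ge_at_top[of 0]
  proof eventually_elim
    case (elim t)
    then show ?case
      using decay[of "t / 2" t]
      by (simp add: \<phi>_def power2_norm_eq_inner power_divide field_simps)
  qed
  then show "((\<lambda>t. t\<^sup>2 * (norm (F (Z t)))\<^sup>2) \<longlongrightarrow> 0) at_top"
    by (intro tendsto_sandwich[OF _ _ tendsto_const lim]) auto
qed

section \<open>Application to the saddle operator\<close>

theorem theorem2p1:
  fixes L :: "(real ^ 'n) \<times> (real ^ 'm) \<Rightarrow> real"
    and xs :: "real ^ 'n" and ys :: "real ^ 'm"
    and z0 :: "(real ^ 'n) \<times> (real ^ 'm)"
    and X :: "real \<Rightarrow> real ^ 'n" and Y :: "real \<Rightarrow> real ^ 'm"
  assumes "L \<in> saddle_class 2"
    and "unique_saddle_point L (xs, ys)"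
    and "is_C1_solution (saddle_op L) z0 (\<lambda>t. (X t, Y t))"
  shows "(\<forall>t>0. L (X t, ys) - L (xs, Y t) \<le> (norm (z0 - (xs, ys)))\<^sup>2 / (2 * t) \<and>
            (norm (saddle_op L (X t, Y t)))\<^sup>2 \<le> (norm (z0 - (xs, ys)))\<^sup>2 / t\<^sup>2) \<and>
         ((\<lambda>t. t * (L (X t, ys) - L (xs, Y t))) \<longlongrightarrow> 0) at_top \<and>
         ((\<lambda>t. t\<^sup>2 * (norm (saddle_op L (X t, Y t)))\<^sup>2) \<longlongrightarrow> 0) at_top"
proof -
  let ?F = "saddle_op L" and ?Z = "\<lambda>t. (X t, Y t)" and ?zs = "(xs, ys)"
  let ?gap = "\<lambda>t. L (X t, ys) - L (xs, Y t)" and ?R = "norm (z0 - (xs, ys))"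
  have C2: "times_cont_diff 2 L"
    using assms(1) by (simp add: saddle_class_def)
  then have gap_le: "L (x, v) - L (u, y) \<le> inner (?F (x, y)) ((x, y) - (u, v))" for x y u v
    using assms(1) by (intro saddle_gap_le_inner_saddle_op times_cont_diff_2D)
      (auto simp: saddle_class_def)
  have mono: "0 \<le> inner (?F z - ?F w) (z - w)" for z w
  proof -
    obtain x y u v where zw: "z = (x, y)" "w = (u, v)" by (cases z, cases w)
    \<comment> \<open>The two lower bounds, from (x, y) towards (u, v) and back, are negatives of
      each other.\<close>
    have "0 \<le> inner (?F z) (z - w) + inner (?F w) (w - z)"
      using gap_le[of x v u y] gap_le[of u y x v] unfolding zw by linarith
    then show ?thesis by (simp add: inner_diff)
  qed
  have gap_nonneg: "0 \<le> L (x, ys) - L (xs, y)" for x y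
    using assms(2) order_trans[of "L (xs, y)" "L (xs, ys)" "L (x, ys)"]
    by (auto simp: unique_saddle_point_def)
  have zs: "0 \<le> inner (?F z) (z - ?zs)" for z
    using order_trans[OF gap_nonneg gap_le[of "fst z" ys xs "snd z"]] by simp
  note flow = mono zs saddle_op_differentiable[OF C2] assms(3)
  note bound = monotone_flow_bound[OF flow]
  have res_lim: "((\<lambda>t. t\<^sup>2 * (norm (?F (?Z t)))\<^sup>2) \<longlongrightarrow> 0) at_top"
    by (rule monotone_flow_residual_tendsto_0[OF flow])
  \<comment> \<open>The expanded square is a sum of three nonnegative terms, so each is at most
    \<open>?R\<^sup>2\<close>. Its cross term dominates 2 t times the gap, whence the constant 2 in
    the first estimate.\<close>
  have bounds: "2 * t * ?gap t \<le> ?R\<^sup>2" "t\<^sup>2 * (norm (?F (?Z t)))\<^sup>2 \<le> ?R\<^sup>2"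
      "(norm (?Z t - ?zs))\<^sup>2 \<le> ?R\<^sup>2" if "0 \<le> t" for t
  proof -
    have "t * ?gap t \<le> t * inner (?F (?Z t)) (?Z t - ?zs)"
      using gap_le that by (intro mult_left_mono) auto
    moreover have "0 \<le> t * ?gap t"
      using that gap_nonneg by simp
    moreover have "0 \<le> (norm (?Z t - ?zs))\<^sup>2" "0 \<le> t\<^sup>2 * (norm (?F (?Z t)))\<^sup>2"
      by simp_all
    ultimately show "2 * t * ?gap t \<le> ?R\<^sup>2" "t\<^sup>2 * (norm (?F (?Z t)))\<^sup>2 \<le> ?R\<^sup>2"
        "(norm (?Z t - ?zs))\<^sup>2 \<le> ?R\<^sup>2"
      using bound[OF that] by linarith+
  qed
  \<comment> \<open>For t \<ge> 0 the root is t |F(Z)|, so this is t times the Cauchy-Schwarz bound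
    |F(Z)| |Z - z*| \<le> |F(Z)| \<open>?R\<close> for the gap, written so that the residual limit
    applies directly.\<close>
  have lim: "((\<lambda>t. sqrt (t\<^sup>2 * (norm (?F (?Z t)))\<^sup>2) * ?R) \<longlongrightarrow> 0) at_top"
    using tendsto_mult_left_zero[OF tendsto_real_sqrt[OF res_lim, simplified]] by simp
  have upper: "\<forall>\<^sub>F t in at_top. t * ?gap t \<le> sqrt (t\<^sup>2 * (norm (?F (?Z t)))\<^sup>2) * ?R"
    using eventually_ge_at_top[of 0]
  proof eventually_elim
    case (elim t)
    have "norm (?Z t - ?zs) \<le> ?R"
      using bounds(3)[OF elim] by (rule power2_le_imp_le) simp
    then have "norm (?F (?Z t)) * norm (?Z t - ?zs) \<le> norm (?F (?Z t)) * ?R"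
      by (rule mult_left_mono) simp
    then have "?gap t \<le> norm (?F (?Z t)) * ?R"
      using gap_le[of "X t" ys xs "Y t"] norm_cauchy_schwarz[of "?F (?Z t)" "?Z t - ?zs"]
      by linarith
    then have "t * ?gap t \<le> t * (norm (?F (?Z t)) * ?R)"
      using elim by (rule mult_left_mono)
    then show ?case using elim by (simp add: real_sqrt_mult)
  qed
  have lower: "\<forall>\<^sub>F t in at_top. 0 \<le> t * ?gap t"
    using gap_nonneg by (intro eventually_at_top_linorderI[of 0] mult_nonneg_nonneg)
  have "((\<lambda>t. t * ?gap t) \<longlongrightarrow> 0) at_top"
    by (rule tendsto_sandwich[OF lower upper tendsto_const lim])
  moreover have "?gap t \<le> ?R\<^sup>2 / (2 * t) \<and> (norm (?F (?Z t)))\<^sup>2 \<le> ?R\<^sup>2 / t\<^sup>2" if "0 < t" for t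
    using bounds(1,2)[of t] that by (simp add: pos_le_divide_eq mult_ac)
  ultimately show ?thesis using res_lim by blast
qed

end
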